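(* Let $S$ be an inverse semigroup with central idempotents and let $K$ be a commutative ring with unit. Then every simple $KS$-module is spectral.
   Context: An inverse semigroup is a semigroup $S$ such that each $s\in S$ has a unique $s^*$ with $ss^*s=s$, $s^*ss^*=s^*$. $E(S)$ is its commutative semigroup of idempotents; $s\le t$ iff $s=et$ for some $e\in E(S)$. Modules $V$ over a $K$-algebra $A$ (including simple ones) are assumed non-degenerate, i.e. $AV=V$. $\widehat{E(S)}$ is the space of non-zero semilattice homomorphisms $\theta\colon E(S)\to\{0,1\}$ with the subspace topology from $\{0,1\}^{E(S)}$; $D(e)=\{\theta\mid\theta(e)=1\}$. Each $s\in S$ acts by the homeomorphism $D(s^*s)\to D(ss^* )$, $(s\theta)(e)=\theta(s^*es)$. The universal groupoid $\mathscr G=\mathscr G(S)$ is the set of classes $[s,\theta]$ of pairs with $\theta\in D(s^*s)$, where $(s,\theta)\sim(t,\theta')$ iff $\theta=\theta'$ and there is $u\le s,t$ with $\theta\in D(u^*u)$. It has basic open sets $(s,U)=\{[s,\theta]\mid\theta\in U\}$ ($U\subseteq D(s^*s)$ open), product $[s,\theta][t,\theta']=[st,\theta']$ defined iff $t\theta'=\theta$, $d([s,\theta])=\theta$, $r([s,\theta])=s\theta$, unit space $\mathscr G^0=\widehat{E(S)}$. With $K$ discrete, $K\mathscr G$ is the $K$-module of functions $\mathscr G\to K$ spanned by those $f$ for which there is an open Hausdorff subspace $V$ such that $f$ vanishes off $V$ and $f|_V$ is continuous with compact support, with product $f\ast g(x)=\sum_{y\in d^{-1}(d(x))}f(xy^{-1})g(y)$.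 The map $s\mapsto\chi_{(s,D(s^*s))}$ extends to a $K$-algebra isomorphism $KS\to K\mathscr G(S)$, through which $KS$-modules are viewed as $K\mathscr G(S)$-modules. For a $K\mathscr G$-module $V$ and $\theta\in\mathscr G^0$, $\mathrm{Res}_\theta(V)=\bigcap_U\chi_UV$, over all compact open $U\subseteq\mathscr G^0$ containing $\theta$; a non-zero $V$ is spectral if $\mathrm{Res}_\theta(V)\neq0$ for some $\theta$. *)

theory Defs
  imports "HOL-Analysis.Analysis" "HOL-Library.Poly_Mapping"
begin

section \<open>Inverse semigroups\<close>

class inverse_semigroup = semigroup_mult +
  assumes ex1_star: "\<exists>!t. s * t * s = s \<and> t * s * t = t"

definition star :: "'s::inverse_semigroup \<Rightarrow> 's" where
  "star s = (THE t. s * t * s = s \<and> t * s * t = t)"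

definition idems :: "'s::inverse_semigroup set" where
  "idems = {e. e * e = e}"

definition nat_le :: "'s::inverse_semigroup \<Rightarrow> 's \<Rightarrow> bool" where
  "nat_le s t \<longleftrightarrow> (\<exists>e\<in>idems. s = e * t)"


section \<open>The space of characters of the idempotents\<close>

text \<open>
  The two-element semilattice is \<^typ>\<open>bool\<close> with conjunction. A character is
  defined on \<^const>\<open>idems\<close> only and is extensional, as required by
  \<^const>\<open>product_topology\<close>.
\<close>

definition chars :: "('s::inverse_semigroup \<Rightarrow> bool) set" where
  "chars = {\<theta> \<in> extensional idems.
     (\<exists>e\<in>idems. \<theta> e) \<and> (\<forall>e\<in>idems. \<forall>f\<in>idems. \<theta> (e * f) \<longleftrightarrow> \<theta> e \<and> \<theta> f)}"

definition chars_top :: "('s::inverse_semigroup \<Rightarrow> bool) topology" where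
  "chars_top = subtopology (product_topology (\<lambda>_. discrete_topology UNIV) idems) chars"

definition dom_chars :: "'s::inverse_semigroup \<Rightarrow> ('s \<Rightarrow> bool) set" where
  "dom_chars e = {\<theta> \<in> chars. \<theta> e}"

definition act_char :: "'s::inverse_semigroup \<Rightarrow> ('s \<Rightarrow> bool) \<Rightarrow> ('s \<Rightarrow> bool)" where
  "act_char s \<theta> = (\<lambda>e\<in>idems. \<theta> (star s * e * s))"


section \<open>The universal groupoid\<close>

definition germ_pairs :: "('s::inverse_semigroup \<times> ('s \<Rightarrow> bool)) set" where
  "germ_pairs = {(s, \<theta>). \<theta> \<in> dom_chars (star s * s)}"

definition germ_rel ::
  "(('s::inverse_semigroup \<times> ('s \<Rightarrow> bool)) \<times> ('s \<times> ('s \<Rightarrow> bool))) set" where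
  "germ_rel = {((s, \<theta>), (t, \<theta>')). (s, \<theta>) \<in> germ_pairs \<and> (t, \<theta>') \<in> germ_pairs \<and> \<theta> = \<theta>' \<and>
     (\<exists>u. nat_le u s \<and> nat_le u t \<and> \<theta> \<in> dom_chars (star u * u))}"

type_synonym 's germ = "('s \<times> ('s \<Rightarrow> bool)) set"

definition germ :: "'s::inverse_semigroup \<Rightarrow> ('s \<Rightarrow> bool) \<Rightarrow> 's germ" where
  "germ s \<theta> = germ_rel `` {(s, \<theta>)}"

definition groupoid :: "'s::inverse_semigroup germ set" where
  "groupoid = germ_pairs // germ_rel"

definition germ_set :: "'s::inverse_semigroup \<Rightarrow> ('s \<Rightarrow> bool) set \<Rightarrow> 's germ set" where
  "germ_set s U = germ s ` U"

definition groupoid_top :: "'s::inverse_semigroup germ topology" where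
  "groupoid_top = topology_generated_by
     {germ_set s U | s U. openin chars_top U \<and> U \<subseteq> dom_chars (star s * s)}"

definition germ_dom :: "'s::inverse_semigroup germ \<Rightarrow> ('s \<Rightarrow> bool)" where
  "germ_dom x = (THE \<theta>. \<exists>s. (s, \<theta>) \<in> germ_pairs \<and> x = germ s \<theta>)"

definition germ_inv :: "'s::inverse_semigroup germ \<Rightarrow> 's germ" where
  "germ_inv x = (THE y. \<exists>s \<theta>. (s, \<theta>) \<in> germ_pairs \<and> x = germ s \<theta> \<and>
     y = germ (star s) (act_char s \<theta>))"

definition germ_mult :: "'s::inverse_semigroup germ \<Rightarrow> 's germ \<Rightarrow> 's germ" where
  "germ_mult x y = (THE z. \<exists>s t \<theta>. (t, \<theta>) \<in> germ_pairs \<and> (s, act_char t \<theta>) \<in> germ_pairs \<and>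
     x = germ s (act_char t \<theta>) \<and> y = germ t \<theta> \<and> z = germ (s * t) \<theta>)"

text \<open>
  The embedding of subsets of the space of characters into the groupoid that comes from
  identifying it with the unit space: \<open>\<theta>\<close> corresponds to \<open>[e, \<theta>]\<close> for any idempotent \<open>e\<close>
  with \<open>\<theta> e = 1\<close>.
\<close>

definition units :: "('s::inverse_semigroup \<Rightarrow> bool) set \<Rightarrow> 's germ set" where
  "units U = {germ e \<theta> | e \<theta>. e \<in> idems \<and> \<theta> \<in> U \<inter> dom_chars e}"


section \<open>The two algebras\<close>

text \<open>
  The sort \<open>{comm_ring, comm_monoid_mult}\<close> is that of commutative rings with unit;
  unlike \<^class>\<open>comm_ring_1\<close> it does not exclude the zero ring.
\<close>

definition chi :: "'x set \<Rightarrow> 'x \<Rightarrow> 'k::{comm_ring, comm_monoid_mult}" where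
  "chi A x = (if x \<in> A then 1 else 0)"

definition groupoid_gens ::
  "('s::inverse_semigroup germ \<Rightarrow> 'k::{comm_ring, comm_monoid_mult}) set" where
  "groupoid_gens = {f. \<exists>V. openin groupoid_top V \<and>
     (let X = subtopology groupoid_top V in
        Hausdorff_space X \<and> (\<forall>x. x \<notin> V \<longrightarrow> f x = 0) \<and>
        continuous_map X (discrete_topology UNIV) f \<and>
        compactin X (X closure_of {x \<in> V. f x \<noteq> 0}))}"

text \<open>
  Functions on the groupoid are extended by \<open>0\<close> to the type of all sets of pairs.
\<close>

definition groupoid_algebra ::
  "('s::inverse_semigroup germ \<Rightarrow> 'k::{comm_ring, comm_monoid_mult}) set" where
  "groupoid_algebra = {f. \<exists>G c. finite G \<and> G \<subseteq> groupoid_gens \<and> f = (\<lambda>x. \<Sum>g\<in>G. c g * g x)}"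

text \<open>
  With this product, \<open>sg_to_groupoid\<close> below is an isomorphism of algebras. Neither the
  transport of a module along it nor \<open>Res\<close> refers to the product explicitly.
  Only finitely many summands of a convolution of elements of \<^const>\<open>groupoid_algebra\<close> are
  non-zero; the sum is restricted to them because a \<^const>\<open>sum\<close> over an infinite set is \<open>0\<close>.
\<close>

definition conv ::
  "('s::inverse_semigroup germ \<Rightarrow> 'k::{comm_ring, comm_monoid_mult}) \<Rightarrow> ('s germ \<Rightarrow> 'k) \<Rightarrow>
   's germ \<Rightarrow> 'k" where
  "conv f g x = (if x \<in> groupoid then
     (\<Sum>y | y \<in> groupoid \<and> germ_dom y = germ_dom x \<and> f (germ_mult x (germ_inv y)) * g y \<noteq> 0.
        f (germ_mult x (germ_inv y)) * g y) else 0)"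

text \<open>
  The semigroup algebra consists of the finitely supported functions on the semigroup; its
  product is not the one of the type class instance of \<^type>\<open>poly_mapping\<close>, which
  is built on an additive monoid.
\<close>

definition sg_mult ::
  "('s::inverse_semigroup \<Rightarrow>\<^sub>0 'k::{comm_ring, comm_monoid_mult}) \<Rightarrow> ('s \<Rightarrow>\<^sub>0 'k) \<Rightarrow> ('s \<Rightarrow>\<^sub>0 'k)" where
  "sg_mult a b = (\<Sum>s\<in>Poly_Mapping.keys a. \<Sum>t\<in>Poly_Mapping.keys b.
     Poly_Mapping.single (s * t) (Poly_Mapping.lookup a s * Poly_Mapping.lookup b t))"

definition sg_smult ::
  "'k::{comm_ring, comm_monoid_mult} \<Rightarrow> ('s::inverse_semigroup \<Rightarrow>\<^sub>0 'k) \<Rightarrow> ('s \<Rightarrow>\<^sub>0 'k)" where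
  "sg_smult c a = Poly_Mapping.map (\<lambda>x. c * x) a"

definition sg_to_groupoid ::
  "('s::inverse_semigroup \<Rightarrow>\<^sub>0 'k::{comm_ring, comm_monoid_mult}) \<Rightarrow> 's germ \<Rightarrow> 'k" where
  "sg_to_groupoid a = (\<lambda>x. \<Sum>s\<in>Poly_Mapping.keys a. Poly_Mapping.lookup a s *
     chi (germ_set s (dom_chars (star s * s))) x)"


section \<open>Modules\<close>

text \<open>
  Modules over the semigroup algebra, which need not have a unit; \<open>nondegenerate\<close> says that
  the finite sums of elements \<open>a v\<close> exhaust the module.
\<close>

locale sg_module =
  fixes kmult :: "'k::{comm_ring, comm_monoid_mult} \<Rightarrow> 'v::ab_group_add \<Rightarrow> 'v"
    and act :: "('s::inverse_semigroup \<Rightarrow>\<^sub>0 'k) \<Rightarrow> 'v \<Rightarrow> 'v"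
  assumes kmult_add_right: "kmult c (v + w) = kmult c v + kmult c w"
    and kmult_add_left: "kmult (c + d) v = kmult c v + kmult d v"
    and kmult_kmult: "kmult c (kmult d v) = kmult (c * d) v"
    and kmult_one: "kmult 1 v = v"
    and act_add_right: "act a (v + w) = act a v + act a w"
    and act_add_left: "act (a + b) v = act a v + act b v"
    and act_kmult_left: "act (sg_smult c a) v = kmult c (act a v)"
    and act_kmult_right: "act a (kmult c v) = kmult c (act a v)"
    and act_act: "act a (act b v) = act (sg_mult a b) v"
    and nondegenerate: "\<exists>(n::nat) a w. v = (\<Sum>i<n. act (a i) (w i))"

definition submodule ::
  "('k::{comm_ring, comm_monoid_mult} \<Rightarrow> 'v::ab_group_add \<Rightarrow> 'v) \<Rightarrow>
   (('s::inverse_semigroup \<Rightarrow>\<^sub>0 'k) \<Rightarrow> 'v \<Rightarrow> 'v) \<Rightarrow> 'v set \<Rightarrow> bool" where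
  "submodule kmult act W \<longleftrightarrow> 0 \<in> W \<and> (\<forall>v\<in>W. \<forall>w\<in>W. v + w \<in> W) \<and>
     (\<forall>c. \<forall>v\<in>W. kmult c v \<in> W) \<and> (\<forall>a. \<forall>v\<in>W. act a v \<in> W)"

locale simple_sg_module = sg_module kmult act
  for kmult :: "'k::{comm_ring, comm_monoid_mult} \<Rightarrow> 'v::ab_group_add \<Rightarrow> 'v"
    and act :: "('s::inverse_semigroup \<Rightarrow>\<^sub>0 'k) \<Rightarrow> 'v \<Rightarrow> 'v" +
  assumes nonzero: "\<exists>v::'v. v \<noteq> 0"
    and simple: "submodule kmult act W \<Longrightarrow> W = {0} \<or> W = UNIV"

text \<open>
  Since \<^const>\<open>sg_to_groupoid\<close> is a bijection onto \<^const>\<open>groupoid_algebra\<close>, a module over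
  the semigroup algebra becomes one over \<^const>\<open>groupoid_algebra\<close> through its inverse.
\<close>

definition transport ::
  "(('s::inverse_semigroup \<Rightarrow>\<^sub>0 'k::{comm_ring, comm_monoid_mult}) \<Rightarrow> 'v \<Rightarrow> 'v) \<Rightarrow>
   ('s germ \<Rightarrow> 'k) \<Rightarrow> 'v \<Rightarrow> 'v" where
  "transport act = (\<lambda>f\<in>groupoid_algebra. act (inv sg_to_groupoid f))"

definition Res ::
  "(('s::inverse_semigroup germ \<Rightarrow> 'k::{comm_ring, comm_monoid_mult}) \<Rightarrow> 'v \<Rightarrow> 'v) \<Rightarrow>
   ('s \<Rightarrow> bool) \<Rightarrow> 'v set" where
  "Res gact \<theta> = (\<Inter>U \<in> {U. openin chars_top U \<and> compactin chars_top U \<and> \<theta> \<in> U}.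
     range (gact (chi (units U))))"

definition spectral ::
  "(('s::inverse_semigroup germ \<Rightarrow> 'k::{comm_ring, comm_monoid_mult}) \<Rightarrow>
    'v::ab_group_add \<Rightarrow> 'v) \<Rightarrow> bool" where
  "spectral gact \<longleftrightarrow> (\<exists>v::'v. v \<noteq> 0) \<and> (\<exists>\<theta>\<in>chars. Res gact \<theta> \<noteq> {0})"

end

theory Submission
  imports Defs
begin

text \<open>
  If \<open>e\<close> is a central idempotent, then \<open>eV\<close> is a submodule, so by simplicity \<open>e\<close> acts on \<open>V\<close> as
  zero or as the identity. The idempotents acting as the identity define a character \<open>\<theta>\<close>. For
  every compact open \<open>U\<close> containing \<open>\<theta>\<close>, the function \<open>\<chi>\<^sub>U\<close> is a linear combination of the
  \<open>\<chi>\<close> of sets \<open>D(e)\<close>, so it acts as the scalar \<open>\<chi>\<^sub>U(\<theta>) = 1\<close>; hence \<open>Res\<^sub>\<theta>(V) = V\<close>.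
\<close>

section \<open>Germs over an inverse semigroup with central idempotents\<close>

lemma star_unique:
  fixes s t :: "'s::inverse_semigroup"
  assumes "s * t * s = s" "t * s * t = t"
  shows "star s = t"
  unfolding star_def using ex1_star[of s] assms by (intro the1_equality) auto

lemma mult_star_mult [simp]: "s * star s * s = (s::'s::inverse_semigroup)"
  and star_mult_star [simp]: "star s * s * star s = star s"
proof -
  obtain t where t: "s * t * s = s" "t * s * t = t"
    using ex1_star[of s] by blast
  with star_unique[OF t] show "s * star s * s = s" "star s * s * star s = star s"
    by simp_all
qed

lemma idems_star_mult [simp]: "star s * s \<in> idems"
  unfolding idems_def by (simp_all flip: mult.assoc)

lemma idems_idem: "e \<in> idems \<Longrightarrow> e * e = e"
  by (simp add: idems_def)

lemma idems_star: "e \<in> idems \<Longrightarrow> star e = e"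
  by (rule star_unique) (simp_all add: idems_def)

lemma chars_mult:
  "\<theta> \<in> chars \<Longrightarrow> e \<in> idems \<Longrightarrow> f \<in> idems \<Longrightarrow> \<theta> (e * f) \<longleftrightarrow> \<theta> e \<and> \<theta> f"
  by (simp add: chars_def)

lemma chars_ex: "\<theta> \<in> chars \<Longrightarrow> \<exists>e\<in>idems. \<theta> e"
  by (simp add: chars_def)

lemma germ_pairs_iff: "(s, \<theta>) \<in> germ_pairs \<longleftrightarrow> \<theta> \<in> chars \<and> \<theta> (star s * s)"
  by (simp add: germ_pairs_def dom_chars_def)

text \<open>The unit of the groupoid at \<open>\<theta>\<close>. For a character the choice of the
  idempotent does not matter, by \<open>germ_idem_eq_unit_germ\<close>.\<close>

definition unit_germ :: "('s::inverse_semigroup \<Rightarrow> bool) \<Rightarrow> 's germ" where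
  "unit_germ \<theta> = germ (SOME e. e \<in> idems \<and> \<theta> e) \<theta>"

locale central_idempotents =
  fixes S :: "'s::inverse_semigroup itself"
  assumes central: "\<And>e s :: 's. e \<in> idems \<Longrightarrow> e * s = s * e"
begin

section \<open>Products of central idempotents and the germ relation\<close>

lemma idems_mult:
  assumes "e \<in> idems" "f \<in> (idems :: 's set)"
  shows "e * f \<in> idems"
proof -
  have "e * f * (e * f) = e * (f * e) * f" by (simp add: mult.assoc)
  also have "f * e = e * f" using central assms by metis
  finally show ?thesis using assms by (simp add: idems_def) (metis mult.assoc)
qed

text \<open>Multiplication by a central idempotent respects products, so it carries the mutually
  inverse \<open>s\<close> and \<open>star s\<close> to mutually inverse elements. This gives the
  domain of an element below \<open>s\<close>.\<close>

lemma star_idem_mult: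
  fixes s :: 's
  assumes e: "e \<in> idems"
  shows "star (e * s) * (e * s) = e * (star s * s)"
proof -
  have prod: "(e * t) * (e * u) = e * (t * u)" for t u
  proof -
    have "(e * t) * (e * u) = e * (t * e) * u" by (simp add: mult.assoc)
    also have "t * e = e * t" using central[OF e] by simp
    also have "e * (e * t) * u = e * (t * u)" using e by (simp add: idems_idem flip: mult.assoc)
    finally show ?thesis .
  qed
  have "star (e * s) = e * star s"
    by (rule star_unique) (simp_all add: prod)
  then show ?thesis by (simp add: prod)
qed

text \<open>A common lower bound \<open>e * s = f * t\<close> yields the single equalizing
  idempotent \<open>e * f\<close>. Conversely \<open>e * s = e * t\<close> is itself a common lower
  bound, with \<open>\<theta>\<close> in its domain. From here on germs are compared without the
  natural order.\<close>

lemma germ_rel_iff: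
  fixes s t :: 's
  shows "((s, \<theta>), (t, \<psi>)) \<in> germ_rel \<longleftrightarrow>
    (s, \<theta>) \<in> germ_pairs \<and> (t, \<psi>) \<in> germ_pairs \<and> \<theta> = \<psi> \<and> (\<exists>e\<in>idems. \<theta> e \<and> e * s = e * t)"
    (is "?L \<longleftrightarrow> ?R")
proof
  assume ?L
  then obtain e f where *: "(s, \<theta>) \<in> germ_pairs" "(t, \<psi>) \<in> germ_pairs" "\<theta> = \<psi>"
    and e: "e \<in> idems" and f: "f \<in> idems" and eq: "e * s = f * t"
    and u: "\<theta> \<in> dom_chars (star (e * s) * (e * s))"
    unfolding germ_rel_def nat_le_def by auto
  have ch: "\<theta> \<in> chars" using u by (simp add: dom_chars_def)
  have "\<theta> (e * (star s * s))" "\<theta> (f * (star t * t))"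
    using u star_idem_mult[OF e, of s] star_idem_mult[OF f, of t] eq
    by (simp_all add: dom_chars_def)
  then have "\<theta> (e * f)" using chars_mult[OF ch] e f by simp
  \<comment> \<open>The factor \<open>f\<close> is absorbed by \<open>e * s\<close>, since the
    latter equals \<open>f * t\<close>; likewise \<open>e\<close> is absorbed by
    \<open>e * s\<close>.\<close>
  moreover have "e * f * s = e * f * t"
  proof -
    have "e * f * s = f * (e * s)" using central[OF e, of f] by (simp add: mult.assoc)
    also have "\<dots> = e * s" unfolding eq using f by (simp add: idems_idem flip: mult.assoc)
    also have "\<dots> = e * (e * s)" using e by (simp add: idems_idem flip: mult.assoc)
    finally show ?thesis by (simp add: eq mult.assoc)
  qed
  ultimately show ?R using * idems_mult[OF e f] by blast
next
  assume ?R
  then obtain e where *: "(s, \<theta>) \<in> germ_pairs" "(t, \<psi>) \<in> germ_pairs" "\<theta> = \<psi>"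
    and e: "e \<in> idems" "\<theta> e" "e * s = e * t" by blast
  have "nat_le (e * s) s" unfolding nat_le_def using e(1) by blast
  moreover have "nat_le (e * s) t" unfolding nat_le_def e(3) using e(1) by blast
  moreover have "\<theta> \<in> dom_chars (star (e * s) * (e * s))"
    using * e unfolding star_idem_mult[OF e(1)] dom_chars_def
    by (simp add: germ_pairs_iff chars_mult)
  ultimately have "\<exists>u. nat_le u s \<and> nat_le u t \<and> \<theta> \<in> dom_chars (star u * u)" by blast
  then show ?L using * by (simp add: germ_rel_def)
qed

text \<open>Reflexivity rests on a character being true at some idempotent; transitivity multiplies
  the two witnessing idempotents.\<close>

lemma equiv_germ_rel: "equiv germ_pairs (germ_rel :: (('s \<times> _) \<times> _) set)"
proof (rule equivI)
  show "germ_rel \<subseteq> germ_pairs \<times> (germ_pairs :: ('s \<times> _) set)"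
    by (auto simp: germ_rel_def)
  show "refl_on germ_pairs (germ_rel :: (('s \<times> _) \<times> _) set)"
    by (auto intro!: refl_onI simp: germ_rel_iff) (auto simp: germ_pairs_iff dest: chars_ex)
  show "sym (germ_rel :: (('s \<times> _) \<times> _) set)"
    by (rule symI) (auto simp: germ_rel_iff, metis)
  show "trans (germ_rel :: (('s \<times> _) \<times> _) set)"
  proof (rule transI, clarify)
    fix s t r :: 's and \<theta> \<psi> \<phi> :: "'s \<Rightarrow> bool"
    assume "((s, \<theta>), (t, \<psi>)) \<in> germ_rel" "((t, \<psi>), (r, \<phi>)) \<in> germ_rel"
    then obtain e f where *: "(s, \<theta>) \<in> germ_pairs" "(r, \<phi>) \<in> germ_pairs" "\<theta> = \<phi>"
      and e: "e \<in> idems" "\<theta> e" "e * s = e * t" and f: "f \<in> idems" "\<theta> f" "f * t = f * r"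
      unfolding germ_rel_iff by blast
    have "\<theta> (e * f)" using e f * by (simp add: chars_mult germ_pairs_iff)
    moreover have "e * f * s = e * f * r"
      by (metis central e f mult.assoc)
    ultimately show "((s, \<theta>), (r, \<phi>)) \<in> germ_rel"
      unfolding germ_rel_iff using * idems_mult[OF e(1) f(1)] by blast
  qed
qed

lemma germ_eq_iff:
  fixes s t :: 's
  assumes "\<theta> \<in> chars" "\<theta> (star s * s)" "\<psi> \<in> chars" "\<psi> (star t * t)"
  shows "germ s \<theta> = germ t \<psi> \<longleftrightarrow> \<theta> = \<psi> \<and> (\<exists>e\<in>idems. \<theta> e \<and> e * s = e * t)"
  unfolding germ_def using assms
  by (subst eq_equiv_class_iff[OF equiv_germ_rel]) (auto simp: germ_rel_iff germ_pairs_iff)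

text \<open>Two idempotents at which \<open>\<theta>\<close> is true become equal after
  multiplication by their product, so they have the same germ.\<close>

lemma germ_idem_eq_unit_germ:
  fixes \<theta> :: "'s \<Rightarrow> bool"
  assumes "\<theta> \<in> chars" "e \<in> idems" "\<theta> e"
  shows "germ e \<theta> = unit_germ \<theta>"
proof -
  define f where "f = (SOME e. e \<in> idems \<and> \<theta> e)"
  have f: "f \<in> idems" "\<theta> f"
    using someI[of "\<lambda>e. e \<in> idems \<and> \<theta> e" e] assms unfolding f_def by auto
  have "germ e \<theta> = germ f \<theta>"
    using assms f idems_mult[OF assms(2) f(1)]
    by (subst germ_eq_iff)
      (auto simp: idems_star idems_idem chars_mult intro!: bexI[of _ "e * f"],
       metis central idems_idem mult.assoc)
  then show ?thesis by (simp add: unit_germ_def f_def)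
qed

text \<open>Comparison with an idempotent \<open>f\<close> asks for \<open>e * s = e * f\<close>.
  Replacing \<open>e\<close> by \<open>e * f\<close> removes \<open>f\<close>: what remains is an
  idempotent below \<open>s\<close> at which \<open>\<psi>\<close> is true.\<close>

lemma germ_eq_unit_germ_iff:
  fixes s :: 's
  assumes "\<theta> \<in> chars" "\<theta> (star s * s)" "\<psi> \<in> chars"
  shows "germ s \<theta> = unit_germ \<psi> \<longleftrightarrow> \<theta> = \<psi> \<and> (\<exists>e\<in>idems. \<psi> e \<and> e * s = e)"
proof -
  obtain f where f: "f \<in> idems" "\<psi> f" using chars_ex assms by blast
  have "germ s \<theta> = unit_germ \<psi> \<longleftrightarrow> \<theta> = \<psi> \<and> (\<exists>e\<in>idems. \<psi> e \<and> e * s = e * f)"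
    using assms f
    by (subst germ_idem_eq_unit_germ[OF assms(3) f, symmetric], subst germ_eq_iff)
      (auto simp: idems_star idems_idem)
  also have "(\<exists>e\<in>idems. \<psi> e \<and> e * s = e * f) \<longleftrightarrow> (\<exists>e\<in>idems. \<psi> e \<and> e * s = e)"
  proof safe
    fix e assume e: "e \<in> idems" "\<psi> e" "e * s = e * f"
    have "e * f * s = e * f" by (metis central e(3) f(1) idems_idem mult.assoc)
    then show "\<exists>e\<in>idems. \<psi> e \<and> e * s = e"
      using e f assms idems_mult by (intro bexI[of _ "e * f"]) (auto simp: chars_mult)
  next
    fix e assume e: "e \<in> idems" "\<psi> e" "e * s = e"
    have "e * f * s = e * f * f" by (metis central e f(1) idems_idem mult.assoc)
    then show "\<exists>e\<in>idems. \<psi> e \<and> e * s = e * f"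
      using e f assms idems_mult by (intro bexI[of _ "e * f"]) (auto simp: chars_mult)
  qed
  finally show ?thesis .
qed

text \<open>A germ determines its base character. Through this, disjointness, intersections and
  differences pass from sets of characters to sets of units.\<close>

lemma inj_on_unit_germ: "inj_on unit_germ (chars :: ('s \<Rightarrow> bool) set)"
proof (rule inj_onI)
  fix \<theta> \<psi> :: "'s \<Rightarrow> bool"
  assume *: "\<theta> \<in> chars" "\<psi> \<in> chars" "unit_germ \<theta> = unit_germ \<psi>"
  obtain e where e: "e \<in> idems" "\<theta> e" using chars_ex * by blast
  then have "germ e \<theta> = unit_germ \<psi>" using germ_idem_eq_unit_germ * by metis
  then show "\<theta> = \<psi>"
    using germ_eq_unit_germ_iff[of \<theta> e \<psi>] * e by (simp add: idems_star idems_idem)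
qed

lemma units_eq_image: "units U = unit_germ ` (U \<inter> (chars :: ('s \<Rightarrow> bool) set))"
proof safe
  fix x assume "x \<in> units U"
  then show "x \<in> unit_germ ` (U \<inter> chars)"
    by (auto simp: units_def dom_chars_def germ_idem_eq_unit_germ)
next
  fix \<theta> :: "'s \<Rightarrow> bool" assume \<theta>: "\<theta> \<in> U" "\<theta> \<in> chars"
  then obtain e where "e \<in> idems" "\<theta> e" using chars_ex by blast
  with \<theta> show "unit_germ \<theta> \<in> units U"
    using germ_idem_eq_unit_germ by (fastforce simp: units_def dom_chars_def)
qed

lemma germ_in_germ_set_iff:
  fixes s t :: 's
  assumes "\<theta> \<in> chars" "\<theta> (star s * s)" "U \<subseteq> dom_chars (star t * t)"
  shows "germ s \<theta> \<in> germ_set t U \<longleftrightarrow> \<theta> \<in> U \<and> germ s \<theta> = germ t \<theta>"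
proof -
  have "germ s \<theta> = germ t \<psi> \<Longrightarrow> \<psi> \<in> U \<Longrightarrow> \<theta> = \<psi>" for \<psi>
    using assms by (subst (asm) germ_eq_iff) (auto simp: dom_chars_def)
  then show ?thesis by (auto simp: germ_set_def)
qed

section \<open>Topology of the characters and of the units\<close>

lemma openin_dom_chars: "openin chars_top (dom_chars e)" (is ?open)
  and closedin_dom_chars: "closedin chars_top (dom_chars e)" (is ?closed)
  if "e \<in> idems" for e :: 's
proof -
  let ?P = "product_topology (\<lambda>_::'s. discrete_topology (UNIV :: bool set)) idems"
  let ?T = "{\<theta> \<in> topspace ?P. \<theta> e \<in> {True}}"
  note cont = continuous_map_product_projection[OF that]
  have eq: "dom_chars e = ?T \<inter> chars"
    by (auto simp: dom_chars_def chars_def PiE_def)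
  have "openin ?P ?T"
    by (rule openin_continuous_map_preimage[OF cont]) simp
  then show ?open unfolding chars_top_def openin_subtopology using eq by blast
  have "closedin ?P ?T"
    by (rule closedin_continuous_map_preimage[OF cont]) simp
  then show ?closed unfolding chars_top_def closedin_subtopology using eq by blast
qed

lemma topspace_chars_top [simp]: "topspace chars_top = (chars :: ('s \<Rightarrow> bool) set)"
  by (auto simp: chars_top_def chars_def PiE_def)

lemma Hausdorff_chars_top: "Hausdorff_space (chars_top :: ('s \<Rightarrow> bool) topology)"
  unfolding chars_top_def
  by (intro Hausdorff_space_subtopology) (auto simp: Hausdorff_space_product_topology)

lemma openin_groupoid_germ_set:
  fixes s :: 's
  assumes "openin chars_top U" "U \<subseteq> dom_chars (star s * s)"
  shows "openin groupoid_top (germ_set s U)"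
  unfolding groupoid_top_def using assms by (intro topology_generated_by_Basis) blast

text \<open>Each piece has the form of a basic open set of \<open>groupoid_top\<close> when
  \<open>U\<close> is open, which is how openness of \<open>units U\<close> is obtained.\<close>

lemma units_eq_Union: "units U = (\<Union>e\<in>idems. germ_set (e :: 's) (U \<inter> dom_chars e))"
  unfolding units_def germ_set_def by blast

lemma openin_groupoid_units:
  assumes "openin chars_top (U :: ('s \<Rightarrow> bool) set)"
  shows "openin groupoid_top (units U)"
  unfolding units_eq_Union using assms
  by (intro openin_Union) (auto intro!: openin_groupoid_germ_set openin_Int openin_dom_chars
      simp: idems_star idems_idem)

lemma continuous_unit_germ:
  "continuous_map chars_top groupoid_top (unit_germ :: ('s \<Rightarrow> bool) \<Rightarrow> 's germ)"
  unfolding groupoid_top_def continuous_on_generated_topo_iff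
proof (intro conjI allI impI)
  fix B :: "'s germ set"
  assume "B \<in> {germ_set s U |s U. openin chars_top U \<and> U \<subseteq> dom_chars (star s * s)}"
  then obtain s U where B: "B = germ_set s U" and U: "openin chars_top U" "U \<subseteq> dom_chars (star s * s)"
    by blast
  have "unit_germ \<psi> \<in> B \<longleftrightarrow> \<psi> \<in> U \<and> (\<exists>e\<in>idems. \<psi> e \<and> e * s = e)" if "\<psi> \<in> chars" for \<psi>
  proof -
    have "unit_germ \<psi> = germ s \<theta> \<longleftrightarrow> \<theta> = \<psi> \<and> (\<exists>e\<in>idems. \<psi> e \<and> e * s = e)" if "\<theta> \<in> U" for \<theta>
      using germ_eq_unit_germ_iff[of \<theta> s \<psi>] U that \<open>\<psi> \<in> chars\<close> by (auto simp: dom_chars_def)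
    then show ?thesis unfolding B germ_set_def by blast
  qed
  \<comment> \<open>The preimage of a basic set is \<open>U\<close> cut down to the characters true
    at some idempotent below \<open>s\<close>, hence an intersection of \<open>U\<close> with a
    union of open sets \<open>dom_chars e\<close>.\<close>
  then have "unit_germ -` B \<inter> topspace chars_top
      = U \<inter> (\<Union>e\<in>{e\<in>idems. e * s = e}. dom_chars e)"
    using U by (auto simp: dom_chars_def)
  then show "openin chars_top (unit_germ -` B \<inter> topspace chars_top)"
    using U by (auto intro!: openin_Int openin_Union openin_dom_chars)
next
  \<comment> \<open>The space of a generated topology is the union of its generators, so the image
    has to be shown to lie in that union.\<close>
  have "units chars = unit_germ ` (chars :: ('s \<Rightarrow> bool) set)"
    by (simp add: units_eq_image)
  moreover have "units chars \<subseteq> \<Union> {germ_set s U |(s::'s) U. openin chars_top U \<and> U \<subseteq> dom_chars (star s * s)}"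
  proof -
    have "openin chars_top (chars \<inter> dom_chars e) \<and> chars \<inter> dom_chars e \<subseteq> dom_chars (star e * e)"
      if "e \<in> idems" for e :: 's
      using that openin_Int[OF openin_topspace openin_dom_chars[OF that]]
      by (simp add: idems_star idems_idem)
    then show ?thesis unfolding units_eq_Union by blast
  qed
  ultimately show "unit_germ ` topspace (chars_top :: ('s \<Rightarrow> bool) topology)
      \<subseteq> \<Union> {germ_set s U |s U. openin chars_top U \<and> U \<subseteq> dom_chars (star s * s)}"
    by simp
qed

text \<open>Open sets separating two characters are carried by \<open>units\<close> to open sets of
  germs, which stay disjoint by injectivity of \<open>unit_germ\<close>.\<close>

lemma Hausdorff_units: "Hausdorff_space (subtopology groupoid_top (units (U :: ('s \<Rightarrow> bool) set)))"
  unfolding Hausdorff_space_def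
proof (intro allI impI, elim conjE)
  fix x y
  assume "x \<in> topspace (subtopology groupoid_top (units U))"
    and "y \<in> topspace (subtopology groupoid_top (units U))" and "x \<noteq> y"
  then obtain \<theta> \<psi> where xy: "x = unit_germ \<theta>" "\<theta> \<in> U" "\<theta> \<in> chars" "y = unit_germ \<psi>" "\<psi> \<in> U" "\<psi> \<in> chars" "\<theta> \<noteq> \<psi>"
    by (auto simp: units_eq_image)
  then have "\<exists>A B. openin chars_top A \<and> openin chars_top B \<and> \<theta> \<in> A \<and> \<psi> \<in> B \<and> disjnt A B"
    using Hausdorff_chars_top[unfolded Hausdorff_space_def, rule_format, of \<theta> \<psi>] by simp
  then obtain A B where AB: "openin chars_top A" "openin chars_top B" "\<theta> \<in> A" "\<psi> \<in> B" "disjnt A B"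
    by blast
  have "disjnt (units A) (units B)"
    unfolding disjnt_iff units_eq_image
  proof (intro allI notI, elim conjE imageE)
    fix z \<alpha> \<beta>
    assume "z = unit_germ \<alpha>" "z = unit_germ \<beta>" "\<alpha> \<in> A \<inter> chars" "\<beta> \<in> B \<inter> chars"
    moreover from this have "\<alpha> = \<beta>" by (intro inj_onD[OF inj_on_unit_germ]) auto
    ultimately show False using AB(5) by (simp add: disjnt_iff)
  qed
  then have "disjnt (units U \<inter> units A) (units U \<inter> units B)"
    unfolding disjnt_iff by blast
  moreover have "openin (subtopology groupoid_top (units U)) (units U \<inter> units A)"
    "openin (subtopology groupoid_top (units U)) (units U \<inter> units B)"
    using AB(1,2) by (auto intro!: openin_subtopology_Int2 openin_groupoid_units)
  moreover have "x \<in> units U \<inter> units A" "y \<in> units U \<inter> units B"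
    unfolding units_eq_image using xy AB(3,4) by blast+
  ultimately show "\<exists>A B. openin (subtopology groupoid_top (units U)) A \<and>
      openin (subtopology groupoid_top (units U)) B \<and> x \<in> A \<and> y \<in> B \<and> disjnt A B"
    by blast
qed

text \<open>The open Hausdorff set can be \<open>units U\<close> itself: the function is constant
  there, and the set is compact as the continuous image of \<open>U\<close>. Membership matters
  because \<open>transport\<close> is defined by restriction to
  \<open>groupoid_algebra\<close>.\<close>

lemma chi_units_in_groupoid_algebra:
  assumes U: "openin chars_top (U :: ('s \<Rightarrow> bool) set)" and "compactin chars_top U"
  shows "(chi (units U) :: 's germ \<Rightarrow> 'k::{comm_ring, comm_monoid_mult}) \<in> groupoid_algebra"
proof -
  let ?X = "subtopology groupoid_top (units U)"
  have "U \<subseteq> chars" using openin_subset[OF U] by simp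
  then have "units U = unit_germ ` U" by (simp add: units_eq_image Int_absorb2)
  then have "compactin groupoid_top (units U)"
    using image_compactin[OF assms(2) continuous_unit_germ] by simp
  then have cpt: "compactin ?X (units U)" by (simp add: compactin_subtopology)
  have top: "topspace ?X = units U"
    using openin_subset[OF openin_groupoid_units[OF U]] by auto
  have "continuous_map ?X (discrete_topology UNIV) (chi (units U) :: _ \<Rightarrow> 'k)"
    by (rule continuous_map_eq[of _ _ "\<lambda>_. 1"]) (auto simp: chi_def)
  \<comment> \<open>The closed support is only placed inside the compact set \<open>units U\<close>,
    because it is empty when \<open>1 = 0\<close> in the coefficients.\<close>
  moreover have "compactin ?X (?X closure_of {x \<in> units U. (chi (units U) x :: 'k) \<noteq> 0})"
    using cpt by (rule closed_compactin) (auto simp: top dest: in_closure_of[THEN iffD1])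
  ultimately have "(chi (units U) :: _ \<Rightarrow> 'k) \<in> groupoid_gens"
    unfolding groupoid_gens_def using openin_groupoid_units[OF U] Hausdorff_units
    by (auto intro!: exI[of _ "units U"] simp: Let_def) (simp add: chi_def)
  then show ?thesis unfolding groupoid_algebra_def
    by (auto intro!: exI[of _ "{chi (units U)}"] exI[of _ "\<lambda>_. 1"])
qed

end

section \<open>Compact open sets of characters\<close>

lemma sg_to_groupoid_eq_sum:
  assumes "finite A" "Poly_Mapping.keys a \<subseteq> A"
  shows "sg_to_groupoid a x =
    (\<Sum>s\<in>A. Poly_Mapping.lookup a s * chi (germ_set s (dom_chars (star s * s))) x)"
  unfolding sg_to_groupoid_def using assms
  by (intro sum.mono_neutral_left) (auto simp: in_keys_iff)

lemma sg_to_groupoid_add: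
  "sg_to_groupoid (a + b) x = sg_to_groupoid a x + sg_to_groupoid b x"
proof -
  let ?A = "Poly_Mapping.keys a \<union> Poly_Mapping.keys b"
  have "sg_to_groupoid c x =
      (\<Sum>s\<in>?A. Poly_Mapping.lookup c s * chi (germ_set s (dom_chars (star s * s))) x)"
    if "c \<in> {a, b, a + b}" for c
    using that Poly_Mapping.keys_add[of a b] by (intro sg_to_groupoid_eq_sum) auto
  then show ?thesis by (simp add: lookup_add distrib_right sum.distrib)
qed

lemma sg_to_groupoid_single:
  "sg_to_groupoid (Poly_Mapping.single s c) x = c * chi (germ_set s (dom_chars (star s * s))) x"
  by (subst sg_to_groupoid_eq_sum[of "{s}"]) auto

text \<open>The linear span of the functions \<open>chi (units (dom_chars e))\<close>, built one
  scaled term at a time so that closure properties follow by induction.\<close>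

inductive_set idem_span :: "('s::inverse_semigroup germ \<Rightarrow> 'k::{comm_ring, comm_monoid_mult}) set"
  where
    zero: "(\<lambda>_. 0) \<in> idem_span"
  | add_chi: "f \<in> idem_span \<Longrightarrow> e \<in> idems \<Longrightarrow> (\<lambda>x. f x + c * chi (units (dom_chars e)) x) \<in> idem_span"

lemma idem_span_chi: "e \<in> idems \<Longrightarrow> chi (units (dom_chars e)) \<in> idem_span"
  using idem_span.add_chi[OF idem_span.zero, of e 1] by simp

lemma idem_span_add:
  assumes "g \<in> idem_span" "f \<in> idem_span"
  shows "(\<lambda>x. f x + g x) \<in> idem_span"
  using assms(1)
proof induction
  case zero
  then show ?case using assms(2) by simp
next
  case (add_chi g e c)
  then show ?case using idem_span.add_chi[of "\<lambda>x. f x + g x" e c] by (simp add: add.assoc)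
qed

lemma idem_span_smult:
  assumes "f \<in> idem_span"
  shows "(\<lambda>x. d * f x) \<in> idem_span"
  using assms
proof induction
  case zero
  then show ?case using idem_span.zero by simp
next
  case (add_chi f e c)
  then show ?case
    using idem_span.add_chi[of "\<lambda>x. d * f x" e "d * c"] by (simp add: distrib_left mult.assoc)
qed

context central_idempotents
begin

section \<open>The ring of sets generated from the domains of idempotents\<close>

lemma units_Int: "units (A \<inter> B) = units A \<inter> units (B :: ('s \<Rightarrow> bool) set)"
  unfolding units_eq_image
  by (subst inj_on_image_Int[OF inj_on_unit_germ, symmetric]) (auto intro: arg_cong[where f = "image _"])

lemma units_Diff: "units (A - B) = units A - units (B :: ('s \<Rightarrow> bool) set)"
  unfolding units_eq_image
  by (subst inj_on_image_set_diff[OF inj_on_unit_germ, symmetric]) (auto intro: arg_cong[where f = "image _"])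

lemma dom_chars_mult:
  "e \<in> idems \<Longrightarrow> f \<in> idems \<Longrightarrow> dom_chars (e * f) = dom_chars e \<inter> dom_chars (f :: 's)"
  by (auto simp: dom_chars_def chars_mult)

text \<open>The product here is pointwise. Generators multiply to generators because
  \<open>dom_chars\<close> turns products of idempotents into intersections; distributivity extends
  this first in \<open>f\<close>, then in \<open>g\<close>.\<close>

lemma idem_span_mult:
  fixes f g :: "'s germ \<Rightarrow> 'k::{comm_ring, comm_monoid_mult}"
  assumes f: "f \<in> idem_span" and g: "g \<in> idem_span"
  shows "(\<lambda>x. f x * g x) \<in> idem_span"
proof -
  have *: "(\<lambda>x. f x * chi (units (dom_chars e)) x) \<in> idem_span" if "e \<in> idems" for e
    using f
  proof induction
    case zero
    then show ?case using idem_span.zero by simp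
  next
    case (add_chi f e' c)
    have "chi (units (dom_chars e')) x * chi (units (dom_chars e)) x
        = (chi (units (dom_chars (e' * e))) x :: 'k)" for x
      using add_chi that by (simp add: chi_def dom_chars_mult units_Int)
    then show ?case
      using idem_span.add_chi[OF add_chi.IH, of "e' * e" c] add_chi that idems_mult
      by (simp add: distrib_right mult.assoc)
  qed
  show ?thesis using g
  proof induction
    case zero
    then show ?case using idem_span.zero by simp
  next
    case (add_chi g e c)
    then show ?case
      using idem_span_add[OF idem_span_smult[OF *[of e], of c] add_chi.IH]
      by (simp add: distrib_left mult.left_commute)
  qed
qed

text \<open>The type argument fixes the coefficient ring, which does not occur in the type of the
  result. The lemmas below show that this is a ring of sets.\<close>

definition idem_ring :: "'k::{comm_ring, comm_monoid_mult} itself \<Rightarrow> ('s \<Rightarrow> bool) set set" where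
  "idem_ring _ = {A. (chi (units A) :: 's germ \<Rightarrow> 'k) \<in> idem_span}"

lemma idem_ring_empty: "{} \<in> idem_ring TYPE('k::{comm_ring, comm_monoid_mult})"
proof -
  have "chi (units {}) = ((\<lambda>_. 0) :: 's germ \<Rightarrow> 'k)" by (auto simp: chi_def units_def)
  then show ?thesis by (simp add: idem_ring_def idem_span.zero)
qed

lemma idem_ring_dom_chars: "e \<in> idems \<Longrightarrow> dom_chars e \<in> idem_ring TYPE('k::{comm_ring, comm_monoid_mult})"
  by (simp add: idem_ring_def idem_span_chi)

lemma idem_ring_Int:
  assumes "A \<in> idem_ring TYPE('k::{comm_ring, comm_monoid_mult})" "B \<in> idem_ring TYPE('k)"
  shows "A \<inter> B \<in> idem_ring TYPE('k)"
proof -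
  have "chi (units (A \<inter> B)) = (\<lambda>x. chi (units A) x * chi (units B) x :: 'k)"
    by (auto simp: chi_def units_Int)
  then show ?thesis using assms idem_span_mult by (simp add: idem_ring_def)
qed

lemma idem_ring_Diff:
  assumes A: "A \<in> idem_ring TYPE('k::{comm_ring, comm_monoid_mult})" and B: "B \<in> idem_ring TYPE('k)"
  shows "A - B \<in> idem_ring TYPE('k)"
proof -
  have "chi (units (A - B)) = (\<lambda>x. chi (units A) x + (- 1) * chi (units (A \<inter> B)) x :: 'k)"
    by (auto simp: chi_def units_Int units_Diff)
  then show ?thesis
    using A idem_span_add[OF idem_span_smult[of "chi (units (A \<inter> B))" "- 1"]] idem_ring_Int[OF A B]
    by (simp add: idem_ring_def)
qed

lemma idem_ring_Un:
  assumes A: "A \<in> idem_ring TYPE('k::{comm_ring, comm_monoid_mult})" and B: "B \<in> idem_ring TYPE('k)"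
  shows "A \<union> B \<in> idem_ring TYPE('k)"
proof -
  have "units (A \<union> B) = units (A - B) \<union> units B" by (auto simp: units_def)
  then have "chi (units (A \<union> B)) = (\<lambda>x. chi (units (A - B)) x + chi (units B) x :: 'k)"
    by (auto simp: chi_def units_Diff)
  then show ?thesis
    using B idem_ring_Diff[OF A B] idem_span_add by (auto simp: idem_ring_def)
qed

text \<open>A basic neighbourhood in the product constrains finitely many coordinates. Prescribing
  the values of \<open>\<theta>\<close> there, inside some \<open>dom_chars e\<close>, means
  intersecting with or removing finitely many sets \<open>dom_chars f\<close>.\<close>

lemma idem_ring_basis:
  assumes U: "openin chars_top U" and \<theta>: "\<theta> \<in> U"
  shows "\<exists>N \<in> idem_ring TYPE('k::{comm_ring, comm_monoid_mult}). openin chars_top N \<and> \<theta> \<in> N \<and> N \<subseteq> U"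
proof -
  obtain T where T: "openin (product_topology (\<lambda>_. discrete_topology UNIV) idems) T" "U = T \<inter> chars"
    using U unfolding chars_top_def openin_subtopology by blast
  then have "\<theta> \<in> T" "\<theta> \<in> chars" using \<theta> by auto
  then obtain W where W: "finite {e \<in> idems. W e \<noteq> (UNIV :: bool set)}"
      "\<theta> \<in> Pi\<^sub>E idems W" "Pi\<^sub>E idems W \<subseteq> T"
    using T(1) unfolding openin_product_topology_alt by force
  \<comment> \<open>Complements are formed only relative to a member of the ring;
    \<open>dom_chars e\<close> is a member containing \<open>\<theta>\<close> from which to
    start.\<close>
  obtain e where e: "e \<in> idems" "\<theta> e" using chars_ex[OF \<open>\<theta> \<in> chars\<close>] by blast
  define F where "F = {e \<in> idems. W e \<noteq> (UNIV :: bool set)}"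
  have "finite F" using W(1) by (simp add: F_def)
  then have "F \<subseteq> idems \<longrightarrow> {\<psi> \<in> dom_chars e. \<forall>f\<in>F. \<psi> f = \<theta> f} \<in> idem_ring TYPE('k) \<and>
    openin chars_top {\<psi> \<in> dom_chars e. \<forall>f\<in>F. \<psi> f = \<theta> f}"
  proof induction
    case empty
    then show ?case using e by (simp add: idem_ring_dom_chars openin_dom_chars)
  next
    case (insert f F)
    let ?N = "{\<psi> \<in> dom_chars e. \<forall>f\<in>F. \<psi> f = \<theta> f}"
    show ?case
    proof
      assume sub: "insert f F \<subseteq> idems"
      then have N: "?N \<in> idem_ring TYPE('k)" "openin chars_top ?N" and f: "f \<in> idems"
        using insert by auto
      have "{\<psi> \<in> dom_chars e. \<forall>f\<in>insert f F. \<psi> f = \<theta> f} =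
          (if \<theta> f then ?N \<inter> dom_chars f else ?N - dom_chars f)"
        by (auto simp: dom_chars_def)
      then show "{\<psi> \<in> dom_chars e. \<forall>f\<in>insert f F. \<psi> f = \<theta> f} \<in> idem_ring TYPE('k) \<and>
          openin chars_top {\<psi> \<in> dom_chars e. \<forall>f\<in>insert f F. \<psi> f = \<theta> f}"
        using N idem_ring_dom_chars[OF f, where ?'k = 'k] openin_dom_chars[OF f] closedin_dom_chars[OF f]
        by (simp add: idem_ring_Int idem_ring_Diff openin_Int openin_diff)
    qed
  qed
  moreover have "F \<subseteq> idems" by (auto simp: F_def)
  moreover have "{\<psi> \<in> dom_chars e. \<forall>f\<in>F. \<psi> f = \<theta> f} \<subseteq> U"
  proof
    fix \<psi> assume "\<psi> \<in> {\<psi> \<in> dom_chars e. \<forall>f\<in>F. \<psi> f = \<theta> f}"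
    then have \<psi>: "\<psi> \<in> chars" "\<And>f. f \<in> F \<Longrightarrow> \<psi> f = \<theta> f" by (auto simp: dom_chars_def)
    \<comment> \<open>Coordinates in \<open>F\<close> agree with \<open>\<theta>\<close>, the other
      idempotents carry no constraint, and off \<open>idems\<close> extensionality forces the value
      \<open>undefined\<close>.\<close>
    have "\<psi> \<in> Pi\<^sub>E idems W"
    proof (rule PiE_I)
      fix f :: 's assume "f \<in> idems"
      then show "\<psi> f \<in> W f" using W(2) \<psi>(2)[of f] by (cases "f \<in> F") (auto simp: F_def)
    next
      fix f :: 's assume "f \<notin> idems"
      then show "\<psi> f = undefined" using \<psi>(1) by (auto simp: chars_def extensional_def)
    qed
    then show "\<psi> \<in> U" using W(3) T(2) \<psi>(1) by auto
  qed
  moreover have "\<theta> \<in> {\<psi> \<in> dom_chars e. \<forall>f\<in>F. \<psi> f = \<theta> f}"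
    using e \<open>\<theta> \<in> chars\<close> by (simp add: dom_chars_def)
  ultimately show ?thesis by blast
qed

text \<open>By \<open>idem_ring_basis\<close>, \<open>U\<close> is covered by open members of the
  ring contained in it; compactness leaves a finite union.\<close>

lemma compact_open_in_idem_ring:
  assumes U: "openin chars_top U" "compactin chars_top U"
  shows "U \<in> idem_ring TYPE('k::{comm_ring, comm_monoid_mult})"
proof -
  let ?C = "{N \<in> idem_ring TYPE('k). openin chars_top N \<and> N \<subseteq> U}"
  have "U \<subseteq> \<Union>?C"
  proof
    fix \<theta> assume "\<theta> \<in> U"
    from idem_ring_basis[OF U(1) this, where ?'k = 'k] show "\<theta> \<in> \<Union>?C" by blast
  qed
  moreover have "\<And>N. N \<in> ?C \<Longrightarrow> openin chars_top N" by simp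
  ultimately obtain \<F> where \<F>: "finite \<F>" "\<F> \<subseteq> ?C" "U \<subseteq> \<Union>\<F>"
    using compactinD[OF U(2), of ?C] by blast
  have "\<F> \<subseteq> ?C \<longrightarrow> \<Union>\<F> \<in> idem_ring TYPE('k)"
    using \<F>(1) by induction (auto simp: idem_ring_empty intro: idem_ring_Un)
  moreover have "U = \<Union>\<F>" using \<F> by blast
  ultimately show ?thesis using \<F>(2) by simp
qed

text \<open>All germs of an idempotent are units. Hence \<open>sg_to_groupoid\<close> sends the
  basis element of \<open>e\<close> to a generator of \<open>idem_span\<close>.\<close>

lemma germ_set_idem: "e \<in> idems \<Longrightarrow> germ_set e (dom_chars (star e * e)) = units (dom_chars (e :: 's))"
  unfolding germ_set_def units_eq_image
  by (auto simp: idems_star idems_idem dom_chars_def germ_idem_eq_unit_germ intro!: image_eqI)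

text \<open>A preimage is assembled term by term from \<open>single e c\<close>, so that
  \<open>inv sg_to_groupoid\<close> returns a true preimage on these functions.\<close>

lemma idem_span_subset_range: "f \<in> idem_span \<Longrightarrow> \<exists>a :: 's \<Rightarrow>\<^sub>0 'k::{comm_ring, comm_monoid_mult}. sg_to_groupoid a = f"
proof (induction rule: idem_span.induct)
  case zero
  then show ?case by (intro exI[of _ 0]) (simp add: sg_to_groupoid_def)
next
  case (add_chi f e c)
  then obtain a where "sg_to_groupoid a = f" by blast
  then show ?case using add_chi
    by (intro exI[of _ "a + Poly_Mapping.single e c"])
      (auto simp: sg_to_groupoid_add sg_to_groupoid_single germ_set_idem)
qed

end

section \<open>The character of a simple module\<close>

context sg_module
begin

section \<open>Linear arithmetic in a module and the action of single elements\<close>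

lemma act_zero_right [simp]: "act a 0 = 0"
  using act_add_right[of a 0 0] by simp

lemma act_zero_left [simp]: "act 0 v = 0"
  using act_add_left[of 0 0 v] by simp

lemma kmult_zero_right [simp]: "kmult c 0 = 0"
  using kmult_add_right[of c 0 0] by simp

lemma kmult_zero_left [simp]: "kmult 0 v = 0"
  using kmult_add_left[of 0 0 v] by simp

lemma act_sum_left: "act (\<Sum>i\<in>I. a i) v = (\<Sum>i\<in>I. act (a i) v)"
  using sum_comp_morphism[of "\<lambda>a. act a v" a I] by (simp add: act_add_left o_def)

lemma act_sum_right: "act a (\<Sum>i\<in>I. w i) = (\<Sum>i\<in>I. act a (w i))"
  using sum_comp_morphism[of "act a" w I] by (simp add: act_add_right o_def)

lemma kmult_sum_left: "kmult (\<Sum>i\<in>I. c i) v = (\<Sum>i\<in>I. kmult (c i) v)"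
  using sum_comp_morphism[of "\<lambda>c. kmult c v" c I] by (simp add: kmult_add_left o_def)

definition sact :: "'s \<Rightarrow> 'v \<Rightarrow> 'v" where
  "sact s = act (Poly_Mapping.single s 1)"

lemma act_eq_sum: "act a v = (\<Sum>s\<in>Poly_Mapping.keys a. kmult (Poly_Mapping.lookup a s) (sact s v))"
proof -
  have "a = (\<Sum>s\<in>Poly_Mapping.keys a. Poly_Mapping.single s (Poly_Mapping.lookup a s))"
    by (rule poly_mapping_eqI) (simp add: lookup_sum lookup_single when_def in_keys_iff)
  then have "act a v = (\<Sum>s\<in>Poly_Mapping.keys a. act (Poly_Mapping.single s (Poly_Mapping.lookup a s)) v)"
    using act_sum_left by metis
  moreover have "act (Poly_Mapping.single s c) v = kmult c (sact s v)" for s c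
    using act_kmult_left[of c "Poly_Mapping.single s 1" v] by (simp add: sg_smult_def sact_def)
  ultimately show ?thesis by simp
qed

lemma sact_sact: "sact s (sact t v) = sact (s * t) v"
proof -
  have "sg_mult (Poly_Mapping.single s (1::'k)) (Poly_Mapping.single t 1) = Poly_Mapping.single (s * t) 1"
    \<comment> \<open>If \<open>1 = 0\<close> then the \<open>single\<close> terms vanish and the
      sums over their keys are empty.\<close>
    by (cases "(1::'k) = 0") (simp_all add: sg_mult_def)
  then show ?thesis by (simp add: sact_def act_act)
qed

lemma sact_zero [simp]: "sact s 0 = 0"
  by (simp add: sact_def)

lemma act_sact_commute:
  assumes "\<And>s. t * s = s * t"
  shows "act a (sact t v) = sact t (act a v)"
  unfolding act_eq_sum[of a]
  by (simp add: sact_def act_sum_right act_kmult_right)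
    (simp add: sact_sact assms flip: sact_def)

end

locale central_simple_module =
  simple_sg_module kmult act + central_idempotents "TYPE('s)"
  for kmult :: "'k::{comm_ring, comm_monoid_mult} \<Rightarrow> 'v::ab_group_add \<Rightarrow> 'v"
    and act :: "('s::inverse_semigroup \<Rightarrow>\<^sub>0 'k) \<Rightarrow> 'v \<Rightarrow> 'v"
begin

section \<open>The character defined by the idempotents acting as the identity\<close>

lemma one_neq_zero: "(1::'k) \<noteq> 0"
  using nonzero kmult_one kmult_zero_left by metis

text \<open>Centrality makes \<open>sact e\<close> commute with the whole action, so its image is
  that of a module endomorphism.\<close>

lemma submodule_range_sact:
  assumes "e \<in> idems"
  shows "submodule kmult act (range (sact e))"
  unfolding submodule_def
proof (intro conjI ballI allI)
  show "0 \<in> range (sact e)" using sact_zero by (metis rangeI)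
  fix v w assume "v \<in> range (sact e)" "w \<in> range (sact e)"
  then show "v + w \<in> range (sact e)" by (auto simp: sact_def simp flip: act_add_right)
next
  fix c v assume "v \<in> range (sact e)"
  then show "kmult c v \<in> range (sact e)" by (auto simp: sact_def simp flip: act_kmult_right)
next
  fix a v assume "v \<in> range (sact e)"
  then show "act a v \<in> range (sact e)"
    using act_sact_commute[OF central[OF assms], of a] by auto
qed

text \<open>Simplicity leaves two possible images for \<open>sact e\<close>, and an idempotent map
  that is surjective is the identity.\<close>

lemma sact_idem_dichotomy:
  assumes "e \<in> idems"
  shows "(\<forall>v. sact e v = 0) \<or> (\<forall>v. sact e v = v)"
proof -
  consider "range (sact e) = {0}" | "range (sact e) = UNIV"
    using simple[OF submodule_range_sact[OF assms]] by blast
  then show ?thesis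
  proof cases
    case 2
    have "sact e v = v" for v
    proof -
      obtain w where "v = sact e w" using 2 by (metis rangeE UNIV_I)
      then show ?thesis using assms by (simp add: sact_sact idems_idem)
    qed
    then show ?thesis by blast
  qed blast
qed

text \<open>Restricted to \<open>idems\<close> because elements of \<open>chars\<close> are
  extensional. By the dichotomy, the value false at an idempotent means that it acts as
  zero.\<close>

definition module_char :: "'s \<Rightarrow> bool" where
  "module_char = (\<lambda>e\<in>idems. \<forall>v. sact e v = v)"

lemma sact_module_char: "e \<in> idems \<Longrightarrow> module_char e \<Longrightarrow> sact e v = v"
  by (simp add: module_char_def)

lemma sact_not_module_char: "e \<in> idems \<Longrightarrow> \<not> module_char e \<Longrightarrow> sact e v = 0"
  using sact_idem_dichotomy[of e] by (auto simp: module_char_def)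

text \<open>Writing \<open>s\<close> as \<open>s * (star s * s)\<close> shows that \<open>s\<close>
  annihilates whatever its domain idempotent annihilates.\<close>

lemma sact_eq_zero:
  assumes "\<not> module_char (star s * s)"
  shows "sact s v = 0"
proof -
  have "sact s v = sact s (sact (star s * s) v)" by (simp add: sact_sact flip: mult.assoc)
  then show ?thesis using assms by (simp add: sact_not_module_char)
qed

lemma module_char_in_chars: "module_char \<in> chars"
proof -
  have "\<exists>e\<in>idems. module_char e"
  proof (rule ccontr)
    \<comment> \<open>If every idempotent acted as zero, so would every \<open>s\<close> and then
      the whole algebra, against non-degeneracy.\<close>
    assume "\<not> ?thesis"
    then have "sact s v = 0" for s v by (intro sact_eq_zero) simp
    then have "act a v = 0" for a v by (simp add: act_eq_sum)
    then have "v = 0" for v :: 'v using nondegenerate[of v] by auto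
    then show False using nonzero by blast
  qed
  moreover have "module_char (e * f) \<longleftrightarrow> module_char e \<and> module_char f"
    if "e \<in> idems" "f \<in> idems" for e f
  proof
    assume "module_char e \<and> module_char f"
    then show "module_char (e * f)"
      using that idems_mult[OF that] by (auto simp: module_char_def simp flip: sact_sact)
  next
    \<comment> \<open>A factor acting as zero would make the product annihilate \<open>v\<close>,
      whereas \<open>e * f\<close> fixes it.\<close>
    assume ef: "module_char (e * f)"
    obtain v :: 'v where v: "v \<noteq> 0" using nonzero by blast
    have "sact e (sact f v) = v" "sact f (sact e v) = v"
      using sact_module_char[OF idems_mult[OF that] ef] central[OF that(1), of f]
      by (simp_all add: sact_sact)
    then show "module_char e \<and> module_char f"
      using v that sact_not_module_char by fastforce
  qed
  ultimately show ?thesis by (auto simp: chars_def module_char_def)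
qed

text \<open>As \<open>e\<close> acts as the identity, \<open>s\<close> and \<open>t\<close> act like
  \<open>e * s\<close> and \<open>e * t\<close>. So elements with equal germs at
  \<open>module_char\<close> act alike.\<close>

lemma sact_cong_germ:
  assumes "e \<in> idems" "module_char e" "e * s = e * t"
  shows "sact s v = sact t v"
  using assms sact_module_char[OF assms(1,2)] sact_sact by metis

text \<open>
  On \<open>V\<close>, an element \<open>s\<close> acts through its germ at the character of \<open>V\<close>, so \<open>a\<close> acts through
  the values of \<^term>\<open>sg_to_groupoid a\<close> on the germs at that character. In particular
  injectivity of \<^const>\<open>sg_to_groupoid\<close> is not required to evaluate \<^const>\<open>transport\<close>.
\<close>

lemma act_eq_self:
  assumes a: "sg_to_groupoid a = chi (units U)" and U: "module_char \<in> U"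
  shows "act a v = v"
proof -
  let ?\<theta> = module_char
  let ?g = "\<lambda>s. germ s ?\<theta>" and ?u = "unit_germ ?\<theta>"
  \<comment> \<open>These are the elements of the support that have a germ at
    \<open>module_char\<close>; all others act as zero by \<open>sact_eq_zero\<close>.\<close>
  define X where "X = {s \<in> Poly_Mapping.keys a. ?\<theta> (star s * s)}"
  have fin: "finite X" by (simp add: X_def)
  note ch = module_char_in_chars
  have germ_value: "sg_to_groupoid a (?g t) = (\<Sum>s | s \<in> X \<and> ?g s = ?g t. Poly_Mapping.lookup a s)"
    if t: "?\<theta> (star t * t)" for t
  proof -
    have "?g t \<in> germ_set s (dom_chars (star s * s)) \<longleftrightarrow> ?\<theta> (star s * s) \<and> ?g s = ?g t" for s
      using germ_in_germ_set_iff[OF ch t order_refl, of s] ch by (auto simp: dom_chars_def)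
    then show ?thesis unfolding sg_to_groupoid_def
      by (intro sum.mono_neutral_cong_right) (auto simp: X_def chi_def)
  qed
  have unit: "?g t = ?u \<longleftrightarrow> (\<exists>e\<in>idems. ?\<theta> e \<and> e * t = e)" if "?\<theta> (star t * t)" for t
    using germ_eq_unit_germ_iff[OF ch that ch] by simp
  have "act a v = (\<Sum>s\<in>X. kmult (Poly_Mapping.lookup a s) (sact s v))"
    unfolding act_eq_sum[of a v]
  proof (rule sum.mono_neutral_right)
    show "\<forall>s\<in>Poly_Mapping.keys a - X. kmult (Poly_Mapping.lookup a s) (sact s v) = 0"
      using sact_eq_zero[of _ v] by (simp add: X_def)
  qed (simp_all add: X_def)
  \<comment> \<open>Grouping by germs makes \<open>sact s v\<close> constant in each inner sum,
    whose coefficients then add up to the value of \<open>sg_to_groupoid a\<close> at that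
    germ.\<close>
  also have "\<dots> = (\<Sum>x\<in>?g ` X. \<Sum>s | s \<in> X \<and> ?g s = x. kmult (Poly_Mapping.lookup a s) (sact s v))"
    using fin by (rule sum.image_gen)
  also have "\<dots> = (\<Sum>x\<in>?g ` X. if x = ?u then v else 0)"
  proof (rule sum.cong[OF refl])
    fix x assume "x \<in> ?g ` X"
    then obtain t where x: "x = ?g t" and t: "?\<theta> (star t * t)" by (auto simp: X_def)
    have "sact s v = sact t v" if "s \<in> X" "?g s = x" for s
    proof -
      have "\<exists>e\<in>idems. ?\<theta> e \<and> e * s = e * t"
        using that germ_eq_iff[OF ch _ ch t, of s] by (simp add: x X_def)
      then show ?thesis using sact_cong_germ by blast
    qed
    then have "(\<Sum>s | s \<in> X \<and> ?g s = x. kmult (Poly_Mapping.lookup a s) (sact s v))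
        = kmult (sg_to_groupoid a x) (sact t v)"
      by (simp add: germ_value[OF t] x kmult_sum_left)
    also have "\<dots> = (if x = ?u then v else 0)"
    proof (cases "x = ?u")
      case True
      then obtain e where e: "e \<in> idems" "?\<theta> e" "e * t = e" using unit[OF t] x by auto
      then have "sact t v = v"
        using sact_module_char[OF e(1,2)] sact_sact by metis
      moreover have "x \<in> units U" using True U ch by (simp add: units_eq_image)
      ultimately show ?thesis using True by (simp add: a chi_def kmult_one)
    next
      case False
      \<comment> \<open>A unit equal to a germ at \<open>module_char\<close> has that same base
        character, hence would be \<open>?u\<close>.\<close>
      have "x \<notin> units U"
      proof
        assume "x \<in> units U"
        then obtain \<psi> where "\<psi> \<in> chars" "x = unit_germ \<psi>" by (auto simp: units_eq_image)
        then show False using False germ_eq_unit_germ_iff[OF ch t, of \<psi>] x by auto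
      qed
      then show ?thesis using False by (simp add: a chi_def)
    qed
    finally show "(\<Sum>s | s \<in> X \<and> ?g s = x. kmult (Poly_Mapping.lookup a s) (sact s v))
        = (if x = ?u then v else 0)" .
  qed
  also have "\<dots> = v"
  proof -
    obtain e where e: "e \<in> idems" "?\<theta> e" using chars_ex[OF ch] by blast
    then have ue: "?u = ?g e" using germ_idem_eq_unit_germ[OF ch] by simp
    have "sg_to_groupoid a ?u = 1" using U ch by (simp add: a chi_def units_eq_image)
    \<comment> \<open>The surviving summand must actually occur: the coefficient sum at
      \<open>?u\<close> is \<open>1\<close>, which is non-zero, so some element of \<open>X\<close>
      has germ \<open>?u\<close>.\<close>
    then have "(\<Sum>s | s \<in> X \<and> ?g s = ?u. Poly_Mapping.lookup a s) \<noteq> 0"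
      using germ_value[of e] e one_neq_zero by (simp add: ue idems_star idems_idem)
    then have "{s. s \<in> X \<and> ?g s = ?u} \<noteq> {}" by (metis sum.empty)
    then have "?u \<in> ?g ` X" by force
    then show ?thesis using fin by simp
  qed
  finally show ?thesis .
qed

text \<open>Compact open sets have characteristic functions in the range of
  \<open>sg_to_groupoid\<close>, so \<open>inv\<close> picks some preimage, and by
  \<open>act_eq_self\<close> every preimage acts as the identity.\<close>

lemma transport_chi_units:
  assumes U: "openin chars_top U" "compactin chars_top U" and "module_char \<in> U"
  shows "transport act (chi (units U)) v = v"
proof -
  let ?f = "chi (units U) :: 's germ \<Rightarrow> 'k"
  obtain a where "sg_to_groupoid a = ?f"
    using idem_span_subset_range[of ?f] compact_open_in_idem_ring[OF U, where ?'k = 'k]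
    by (auto simp: idem_ring_def)
  then have "?f \<in> range sg_to_groupoid" by (metis rangeI)
  then have "sg_to_groupoid (inv sg_to_groupoid ?f) = ?f" by (rule f_inv_into_f)
  then show ?thesis
    using chi_units_in_groupoid_algebra[OF U, where ?'k = 'k] assms(3)
    by (simp add: transport_def act_eq_self)
qed

lemma spectral_transport: "spectral (transport act)"
proof -
  obtain v :: 'v where v: "v \<noteq> 0" using nonzero by blast
  \<comment> \<open>Each operator in the intersection fixes \<open>v\<close>, so \<open>v\<close>
    lies in every range.\<close>
  have "v \<in> Res (transport act) module_char"
    unfolding Res_def using transport_chi_units by (auto intro: range_eqI[OF sym])
  then show ?thesis unfolding spectral_def using v module_char_in_chars by blast
qed

end

theorem proposition6p34:
  fixes kmult :: "'k::{comm_ring, comm_monoid_mult} \<Rightarrow> 'v::ab_group_add \<Rightarrow> 'v"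
    and act :: "('s::inverse_semigroup \<Rightarrow>\<^sub>0 'k) \<Rightarrow> 'v \<Rightarrow> 'v"
  assumes "\<forall>e\<in>idems. \<forall>s::'s. e * s = s * e"
    and "simple_sg_module kmult act"
  shows "spectral (transport act)"
proof -
  interpret simple_sg_module kmult act by fact
  interpret central_simple_module kmult act
    by unfold_locales (use assms(1) in blast)
  show ?thesis by (rule spectral_transport)
qed

end
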